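(* There exists a crowded countable (hence countably tight) Tychonoff space $X$ that is neither $\omega\mathrm{N}$-tight nor $C_2$-tight.
   Context: For a property $\mathcal{P}$ that a subspace of a topological space may have, a space $X$ is called $\mathcal{P}$-tight if for all $x\in X$ and $A\subseteq X$ with $x\in\overline{A}$ there is $B\subseteq A$ such that $x\in\overline{B}$ and $B$ has property $\mathcal{P}$. The properties used are: $C_2$: $B$ is second-countable in the subspace topology; $\omega\mathrm{N}$: $B$ is countable and nowhere dense in $X$. Countably tight means $\mathcal{P}$-tight for $\mathcal{P}$ = "countable". A space is crowded if it has no isolated points. *)

theory Defs
  imports "HOL-Analysis.Analysis"
begin

(* A property of subspaces may refer to the ambient space (nowhere density does),
   so it is a predicate on pairs of a topology and a subset. *)
definition tight_wrt :: "('a topology \<Rightarrow> 'a set \<Rightarrow> bool) \<Rightarrow> 'a topology \<Rightarrow> bool" where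
  "tight_wrt P X \<longleftrightarrow>
     (\<forall>x\<in>topspace X. \<forall>A\<subseteq>topspace X. x \<in> X closure_of A \<longrightarrow>
        (\<exists>B\<subseteq>A. x \<in> X closure_of B \<and> P X B))"

definition C2_subspace :: "'a topology \<Rightarrow> 'a set \<Rightarrow> bool" where
  "C2_subspace X B \<longleftrightarrow> second_countable (subtopology X B)"

definition nowhere_dense_in :: "'a topology \<Rightarrow> 'a set \<Rightarrow> bool" where
  "nowhere_dense_in X B \<longleftrightarrow> B \<subseteq> topspace X \<and> X interior_of (X closure_of B) = {}"

definition omegaN_subspace :: "'a topology \<Rightarrow> 'a set \<Rightarrow> bool" where
  "omegaN_subspace X B \<longleftrightarrow> countable B \<and> nowhere_dense_in X B"

definition countably_tight :: "'a topology \<Rightarrow> bool" where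
  "countably_tight X \<longleftrightarrow> tight_wrt (\<lambda>_ B. countable B) X"

definition crowded_space :: "'a topology \<Rightarrow> bool" where
  "crowded_space X \<longleftrightarrow> (\<forall>x\<in>topspace X. \<not> openin X {x})"

definition Tychonoff_space :: "'a topology \<Rightarrow> bool" where
  "Tychonoff_space X \<longleftrightarrow> completely_regular_space X \<and> t1_space X"

end

theory Submission
  imports Defs
begin

text \<open>
  Fix an independent family of subsets \<open>A (p, N)\<close> of \<open>nat\<close>, one for each point \<open>p\<close> and each set \<open>N\<close>.
  Replacing \<open>A (p, N)\<close> by \<open>(A (p, N) - N) \<union> {p}\<close> does no harm to independence as long as every Boolean
  combination of the family has infinitely many points outside \<open>N\<close>.  By Zorn's lemma there is a
  maximal set of such replacements.  The sets of the resulting family and their complements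
  generate a crowded zero-dimensional Hausdorff topology, and by maximality every set with empty
  interior is closed.  So a point is never in the closure of a nowhere dense set that omits it.
  A second-countable set that accumulates at a point outside itself cannot have empty interior;
  but a first-countable nonempty open set would contain a nontrivial convergent sequence, whose
  range has empty interior without being closed.
\<close>

section \<open>Independent families and their existence\<close>

text \<open>The Boolean combinations of the family. Overlapping \<open>G\<close> and
  \<open>H\<close> are allowed and give the empty set, so that cells are closed under
  intersection.\<close>

definition cell :: "('i \<Rightarrow> 'a set) \<Rightarrow> 'i set \<Rightarrow> 'i set \<Rightarrow> 'a set" where
  "cell B G H = {x. (\<forall>i\<in>G. x \<in> B i) \<and> (\<forall>i\<in>H. x \<notin> B i)}"

definition independent_family :: "('i \<Rightarrow> 'a set) \<Rightarrow> bool" where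
  "independent_family B \<longleftrightarrow>
     (\<forall>G H. finite G \<and> finite H \<and> G \<inter> H = {} \<longrightarrow> infinite (cell B G H))"

lemma cell_Int: "cell B G H \<inter> cell B G' H' = cell B (G \<union> G') (H \<union> H')"
  by (auto simp: cell_def)

text \<open>One point from the symmetric difference of each pair of distinct members suffices, and
  there are finitely many pairs.\<close>

lemma finite_separating_set:
  assumes "finite (\<F> :: 'a set set)"
  obtains F where "finite F" "\<And>S T. \<lbrakk>S \<in> \<F>; T \<in> \<F>; S \<inter> F = T \<inter> F\<rbrakk> \<Longrightarrow> S = T"
proof -
  define d where "d S T = (SOME x. (x \<in> S) \<noteq> (x \<in> T))" for S T :: "'a set"
  have d: "(d S T \<in> S) \<noteq> (d S T \<in> T)" if "S \<noteq> T" for S T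
    unfolding d_def by (rule someI_ex) (use that in blast)
  define F where "F = (\<lambda>(S, T). d S T) ` (\<F> \<times> \<F>)"
  show thesis
  proof
    show "finite F"
      using assms by (simp add: F_def)
    show "S = T" if "S \<in> \<F>" "T \<in> \<F>" "S \<inter> F = T \<inter> F" for S T
    proof (rule ccontr)
      assume "S \<noteq> T"
      moreover have "d S T \<in> F"
        using that by (auto simp: F_def)
      ultimately show False
        using d[of S T] that(3) by blast
    qed
  qed
qed

text \<open>
  Hausdorff's construction: the underlying countable set consists of the pairs of a finite set
  \<open>F\<close> and a finite family of subsets of \<open>F\<close>, here coded by lists, and \<open>S\<close> is represented by the pairs
  whose family contains \<open>S \<inter> F\<close>.
\<close>
lemma ex_independent_family:
  "\<exists>A :: 'a::countable set \<Rightarrow> nat set. independent_family A"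
proof -
  define D :: "'a set \<Rightarrow> ('a list \<times> 'a list list) set"
    where "D S = {(xs, ps). S \<inter> set xs \<in> set ` set ps}" for S
  define A :: "'a set \<Rightarrow> nat set" where "A S = from_nat -` D S" for S
  have "infinite (cell A G H)" if fin: "finite G" "finite H" and disj: "G \<inter> H = {}" for G H
  proof -
    from fin obtain F where "finite F"
      and sep: "\<And>S T. \<lbrakk>S \<in> G \<union> H; T \<in> G \<union> H; S \<inter> F = T \<inter> F\<rbrakk> \<Longrightarrow> S = T"
      using finite_separating_set[of "G \<union> H"] by blast
    obtain xs where xs: "set xs = insert undefined F"
      using \<open>finite F\<close> finite_list by (metis finite_insert)
    \<comment> \<open>The family to be coded consists of the traces of the members of
      \<open>G\<close>. No member of \<open>H\<close> has its trace there, since \<open>F\<close>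
      separates \<open>G\<close> from \<open>H\<close>.\<close>
    have "\<exists>ps. set ` set ps = (\<lambda>S. S \<inter> set xs) ` G"
    proof -
      obtain Gs where Gs: "set Gs = G"
        using fin(1) finite_list by blast
      have "\<forall>S. \<exists>l. set l = S \<inter> set xs"
        by (simp add: finite_list)
      then obtain l where "\<And>S. set (l S) = S \<inter> set xs"
        by metis
      then have "set ` set (map l Gs) = (\<lambda>S. S \<inter> set xs) ` G"
        by (simp add: Gs image_image)
      then show ?thesis ..
    qed
    then obtain ps where ps: "set ` set ps = (\<lambda>S. S \<inter> set xs) ` G" ..
    \<comment> \<open>Since \<open>undefined\<close> was put into \<open>set xs\<close>, padding
      with it changes the length of the list but not its set, so one suitable pair yields infinitely
      many.\<close>
    define e where "e n = (replicate n undefined @ xs, ps)" for n :: nat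
    have set_e: "set (fst (e n)) = set xs" for n
      by (auto simp: e_def xs)
    have in_D: "e n \<in> D S \<longleftrightarrow> S \<inter> set xs \<in> (\<lambda>S. S \<inter> set xs) ` G" for n S
      using set_e[of n] by (simp add: D_def e_def ps del: set_append)
    have notin_D: "e n \<notin> D S" if "S \<in> H" for n S
    proof
      assume "e n \<in> D S"
      then obtain T where "T \<in> G" "S \<inter> set xs = T \<inter> set xs"
        unfolding in_D by blast
      moreover from this have "S \<inter> F = T \<inter> F"
        unfolding xs by blast
      ultimately show False
        using sep[of S T] \<open>S \<in> H\<close> disj by blast
    qed
    have "range (\<lambda>n. to_nat (e n)) \<subseteq> cell A G H"
      using in_D notin_D by (auto simp: cell_def A_def)
    moreover have "inj (\<lambda>n. to_nat (e n))"
      by (auto simp: inj_def e_def dest: arg_cong[where f = length])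
    ultimately show ?thesis
      using infinite_super range_inj_infinite by blast
  qed
  then show ?thesis
    unfolding independent_family_def by blast
qed

lemma independent_family_compose:
  fixes f :: "'i \<Rightarrow> 'j"
  assumes "independent_family A" "inj f"
  shows "independent_family (A \<circ> f)"
  unfolding independent_family_def
proof (intro allI impI, elim conjE)
  fix G H :: "'i set"
  assume "finite G" "finite H" "G \<inter> H = {}"
  then have "infinite (cell A (f ` G) (f ` H))"
    using assms by (simp add: independent_family_def flip: image_Int)
  moreover have "cell (A \<circ> f) G H = cell A (f ` G) (f ` H)"
    by (auto simp: cell_def)
  ultimately show "infinite (cell (A \<circ> f) G H)"
    by simp
qed

text \<open>A pair \<open>(p, N)\<close> is coded by a subset of the countable sum
  \<open>'a + 'a\<close>: the left part records \<open>p\<close>, the right part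
  \<open>N\<close>.\<close>

lemma ex_independent_family_point_set:
  "\<exists>A :: 'a::countable \<times> 'a set \<Rightarrow> nat set. independent_family A"
proof -
  define f :: "'a \<times> 'a set \<Rightarrow> ('a + 'a) set" where "f = (\<lambda>(p, N). insert (Inl p) (Inr ` N))"
  have "Inl -` f i = {fst i}" "Inr -` f i = snd i" for i
    by (auto simp: f_def split: prod.splits)
  then have "inj f"
    by (metis injI prod_eqI singleton_inject)
  then show ?thesis
    using ex_independent_family independent_family_compose by blast
qed

section \<open>Maximal modification of an independent family\<close>

definition modify ::
  "('a \<times> 'a set \<Rightarrow> 'a set) \<Rightarrow> ('a \<times> 'a set) set \<Rightarrow> 'a \<times> 'a set \<Rightarrow> 'a set" where
  "modify A M i = (if i \<in> M then insert (fst i) (A i - snd i) else A i)"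

text \<open>Independence has finite character: a cell involves finitely many indices, and on these
  the union of the chain agrees with one of its members.\<close>

lemma independent_family_modify_Union:
  fixes A :: "'a \<times> 'a set \<Rightarrow> 'a set"
  assumes chain: "subset.chain {M. independent_family (modify A M)} \<C>" and ne: "\<C> \<noteq> {}"
  shows "independent_family (modify A (\<Union>\<C>))"
  unfolding independent_family_def
proof (intro allI impI, elim conjE)
  fix G H :: "('a \<times> 'a set) set"
  assume fin: "finite G" "finite H" and disj: "G \<inter> H = {}"
  have "finite ((G \<union> H) \<inter> \<Union>\<C>)" "(G \<union> H) \<inter> \<Union>\<C> \<subseteq> \<Union>\<C>"
    using fin by auto
  then obtain M where M: "M \<in> \<C>" "(G \<union> H) \<inter> \<Union>\<C> \<subseteq> M"
    using finite_subset_Union_chain[OF _ _ ne chain] by metis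
  then have "modify A (\<Union>\<C>) i = modify A M i" if "i \<in> G \<union> H" for i
    using that by (auto simp: modify_def)
  then have "cell (modify A (\<Union>\<C>)) G H = cell (modify A M) G H"
    by (auto simp: cell_def)
  moreover have "independent_family (modify A M)"
    using M(1) chain by (auto simp: subset.chain_def)
  ultimately show "infinite (cell (modify A (\<Union>\<C>)) G H)"
    using fin disj by (simp add: independent_family_def)
qed

text \<open>Outside \<open>N\<close> and \<open>p\<close> the replacement changes no membership, so
  each new cell contains the old one with \<open>N\<close> and a single point removed.\<close>

lemma independent_family_modify_insert:
  fixes A :: "'a \<times> 'a set \<Rightarrow> 'a set"
  assumes inf: "\<And>G H. \<lbrakk>finite G; finite H; G \<inter> H = {}\<rbrakk> \<Longrightarrow> infinite (cell (modify A M) G H - N)"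
  shows "independent_family (modify A (insert (p, N) M))"
  unfolding independent_family_def
proof (intro allI impI, elim conjE)
  fix G H :: "('a \<times> 'a set) set"
  assume "finite G" "finite H" "G \<inter> H = {}"
  then have "infinite (cell (modify A M) G H - N - {p})"
    using inf by simp
  moreover have "cell (modify A M) G H - N - {p} \<subseteq> cell (modify A (insert (p, N) M)) G H"
    by (fastforce simp: cell_def modify_def split: if_splits)
  ultimately show "infinite (cell (modify A (insert (p, N) M)) G H)"
    using infinite_super by blast
qed

text \<open>For a maximal \<open>M\<close>, every replacement that would preserve independence has
  already been made, so \<open>(p, N)\<close> lies in \<open>M\<close>.\<close>

lemma ex_saturated_independent_family:
  "\<exists>B :: nat \<times> nat set \<Rightarrow> nat set. independent_family B \<and>
     (\<forall>N p. (\<forall>G H. finite G \<and> finite H \<and> G \<inter> H = {} \<longrightarrow> infinite (cell B G H - N)) \<and> p \<notin> N \<longrightarrow>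
        p \<in> B (p, N) \<and> B (p, N) \<inter> N = {})"
proof -
  obtain A :: "nat \<times> nat set \<Rightarrow> nat set" where A: "independent_family A"
    using ex_independent_family_point_set by blast
  let ?\<A> = "{M. independent_family (modify A M)}"
  have "modify A {} = A"
    by (simp add: modify_def fun_eq_iff)
  with A have "?\<A> \<noteq> {}"
    by (metis (mono_tags) empty_iff mem_Collect_eq)
  moreover have "\<Union>\<C> \<in> ?\<A>" if "\<C> \<noteq> {}" "subset.chain ?\<A> \<C>" for \<C>
    using independent_family_modify_Union[OF that(2,1)] by simp
  ultimately obtain M where M: "M \<in> ?\<A>" and max: "\<And>M'. \<lbrakk>M' \<in> ?\<A>; M \<subseteq> M'\<rbrakk> \<Longrightarrow> M' = M"
    using subset_Zorn_nonempty[of ?\<A>] by metis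
  have "p \<in> modify A M (p, N) \<and> modify A M (p, N) \<inter> N = {}"
    if "\<And>G H. \<lbrakk>finite G; finite H; G \<inter> H = {}\<rbrakk> \<Longrightarrow> infinite (cell (modify A M) G H - N)"
      and "p \<notin> N" for N p
  proof -
    have "insert (p, N) M = M"
      using independent_family_modify_insert[OF that(1)] max by blast
    then have "(p, N) \<in> M"
      by blast
    with \<open>p \<notin> N\<close> show ?thesis
      by (auto simp: modify_def)
  qed
  with M show ?thesis
    by (intro exI[of _ "modify A M"]) simp
qed

section \<open>The topology with the cells as a base\<close>

definition cell_topology :: "('i \<Rightarrow> 'a set) \<Rightarrow> 'a topology" where
  "cell_topology B =
     topology (\<lambda>U. \<forall>x\<in>U. \<exists>G H. finite G \<and> finite H \<and> x \<in> cell B G H \<and> cell B G H \<subseteq> U)"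

lemma openin_cell_topology:
  "openin (cell_topology B) U \<longleftrightarrow>
     (\<forall>x\<in>U. \<exists>G H. finite G \<and> finite H \<and> x \<in> cell B G H \<and> cell B G H \<subseteq> U)" (is "_ \<longleftrightarrow> ?O U")
proof -
  have "istopology ?O"
    unfolding istopology_def
  proof (intro conjI allI impI ballI)
    fix S T x assume "?O S" "?O T" "x \<in> S \<inter> T"
    then obtain G H G' H' where
      "finite G" "finite H" "x \<in> cell B G H" "cell B G H \<subseteq> S"
      "finite G'" "finite H'" "x \<in> cell B G' H'" "cell B G' H' \<subseteq> T"
      by (meson IntD1 IntD2)
    then show "\<exists>G H. finite G \<and> finite H \<and> x \<in> cell B G H \<and> cell B G H \<subseteq> S \<inter> T"
      using cell_Int[of B G H G' H']
      by (intro exI[of _ "G \<union> G'"] exI[of _ "H \<union> H'"]) auto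
  next
    fix \<K> x assume "\<forall>K\<in>\<K>. ?O K" "x \<in> \<Union>\<K>"
    then show "\<exists>G H. finite G \<and> finite H \<and> x \<in> cell B G H \<and> cell B G H \<subseteq> \<Union>\<K>"
      by (meson UnionE Union_upper order_trans)
  qed
  then show ?thesis
    by (simp add: cell_topology_def)
qed

lemma openin_cell: "\<lbrakk>finite G; finite H\<rbrakk> \<Longrightarrow> openin (cell_topology B) (cell B G H)"
  unfolding openin_cell_topology by blast

lemma topspace_cell_topology [simp]: "topspace (cell_topology B) = UNIV"
proof -
  have "cell B {} {} = UNIV"
    by (simp add: cell_def)
  then show ?thesis
    using openin_cell[of "{}" "{}" B] openin_subset by fastforce
qed

lemma openin_cell_generator:
  "openin (cell_topology B) (B i)" "openin (cell_topology B) (- B i)"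
proof -
  have "cell B {i} {} = B i" "cell B {} {i} = - B i"
    by (auto simp: cell_def)
  then show "openin (cell_topology B) (B i)" "openin (cell_topology B) (- B i)"
    by (metis openin_cell finite.emptyI finite_insert)+
qed

lemma closedin_cell: "closedin (cell_topology B) (cell B G H)"
proof -
  have "- cell B G H = (\<Union>i\<in>G. - B i) \<union> (\<Union>i\<in>H. B i)"
    by (auto simp: cell_def)
  then have "openin (cell_topology B) (- cell B G H)"
    by (auto simp: openin_cell_generator intro!: openin_Un openin_Union)
  then show ?thesis
    by (simp add: closedin_def Compl_eq_Diff_UNIV)
qed

text \<open>Cells are clopen. Complete regularity of the final space comes from here.\<close>

lemma zero_dimensional_cell_topology: "cell_topology B dim_le 0"
  unfolding dimension_le_0_neighbourhood_base_of_clopen neighbourhood_base_of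
proof (intro allI impI, elim conjE)
  fix W x assume "openin (cell_topology B) W" "x \<in> W"
  then obtain G H where "finite G" "finite H" "x \<in> cell B G H" "cell B G H \<subseteq> W"
    unfolding openin_cell_topology by meson
  then show "\<exists>U V. openin (cell_topology B) U \<and>
      (closedin (cell_topology B) V \<and> openin (cell_topology B) V) \<and> x \<in> U \<and> U \<subseteq> V \<and> V \<subseteq> W"
    using openin_cell[of G H B] closedin_cell[of B G H]
    by (intro exI[of _ "cell B G H"]) simp
qed

section \<open>Submaximal spaces and the example\<close>

text \<open>Finite sets are closed, so deleting all but one point of a finite open set would isolate
  that point.\<close>

lemma infinite_openin_crowded:
  assumes "crowded_space X" "t1_space X" "openin X U" "U \<noteq> {}"
  shows "infinite U"
proof
  assume "finite U"
  obtain x where "x \<in> U"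
    using assms(4) by blast
  have "closedin X (U - {x})"
    using assms \<open>finite U\<close> openin_subset[OF assms(3)]
    by (auto simp: t1_space_closedin_finite)
  then have "openin X (U - (U - {x}))"
    using assms(3) by blast
  moreover have "U - (U - {x}) = {x}"
    using \<open>x \<in> U\<close> by blast
  ultimately show False
    using assms(1,3) \<open>x \<in> U\<close> openin_subset by (fastforce simp: crowded_space_def)
qed

text \<open>The usual condition that dense sets are open, stated for complements: a set has empty
  interior exactly when its complement is dense.\<close>

definition submaximal_space :: "'a topology \<Rightarrow> bool" where
  "submaximal_space X \<longleftrightarrow> (\<forall>N\<subseteq>topspace X. X interior_of N = {} \<longrightarrow> closedin X N)"

lemma ex_submaximal_topology:
  "\<exists>X :: nat topology. topspace X = UNIV \<and> X dim_le 0 \<and> Hausdorff_space X \<and>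
     crowded_space X \<and> submaximal_space X"
proof -
  obtain B :: "nat \<times> nat set \<Rightarrow> nat set" where ind: "independent_family B"
    and sat: "\<And>N p. \<lbrakk>\<And>G H. \<lbrakk>finite G; finite H; G \<inter> H = {}\<rbrakk> \<Longrightarrow> infinite (cell B G H - N); p \<notin> N\<rbrakk>
                \<Longrightarrow> p \<in> B (p, N) \<and> B (p, N) \<inter> N = {}"
    using ex_saturated_independent_family by metis
  define X where "X = cell_topology B"
  have inf: "infinite (cell B G H)" if "finite G" "finite H" "G \<inter> H = {}" for G H
    using ind that by (simp add: independent_family_def)
  have crowded: "crowded_space X"
    unfolding crowded_space_def
  proof (intro ballI notI)
    fix x assume "openin X {x}"
    then obtain G H where GH: "finite G" "finite H" "x \<in> cell B G H" "cell B G H \<subseteq> {x}"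
      unfolding X_def openin_cell_topology by blast
    moreover have "G \<inter> H = {}"
      using GH(3) by (auto simp: cell_def)
    ultimately show False
      using inf finite_subset by blast
  qed
  have Hausdorff: "Hausdorff_space X"
    unfolding Hausdorff_space_def
  proof (intro allI impI, elim conjE)
    fix x y :: nat
    assume "x \<noteq> y"
    \<comment> \<open>Saturation applies to \<open>N = {y}\<close> because an infinite cell stays
      infinite without one point.\<close>
    then have "x \<in> B (x, {y}) \<and> B (x, {y}) \<inter> {y} = {}"
      using inf by (intro sat) auto
    then show "\<exists>U V. openin X U \<and> openin X V \<and> x \<in> U \<and> y \<in> V \<and> disjnt U V"
      unfolding X_def
      by (intro exI[of _ "B (x, {y})"] exI[of _ "- B (x, {y})"])
         (auto simp: openin_cell_generator disjnt_def)
  qed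
  have t1: "t1_space X"
    using Hausdorff Hausdorff_imp_t1_space by blast
  have "closedin X N" if int: "X interior_of N = {}" for N
  proof -
    \<comment> \<open>If only finitely many points of a cell lay outside \<open>N\<close>, deleting
      them would leave an open subset of \<open>N\<close>, which is empty; the cell would then be
      finite.\<close>
    have infN: "infinite (cell B G H - N)" if GH: "finite G" "finite H" "G \<inter> H = {}" for G H
    proof
      assume fin: "finite (cell B G H - N)"
      have "openin X (cell B G H - (cell B G H - N))"
        using GH fin t1 openin_cell[of G H B]
        by (auto simp: t1_space_closedin_finite X_def intro!: openin_diff)
      moreover have "cell B G H - (cell B G H - N) \<subseteq> N"
        by blast
      ultimately have "cell B G H - (cell B G H - N) = {}"
        using int interior_of_maximal by blast
      then show False
        using inf[OF GH] fin by (metis Diff_eq_empty_iff finite_subset)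
    qed
    \<comment> \<open>The witness is \<open>B (p, N)\<close>, an open neighbourhood of
      \<open>p\<close> that misses \<open>N\<close>.\<close>
    have "\<exists>T. openin X T \<and> p \<in> T \<and> T \<subseteq> - N" if "p \<in> - N" for p
      using sat[OF infN, of p] that openin_cell_generator(1)[of B] unfolding X_def by blast
    then have "openin X (- N)"
      by (subst openin_subopen) blast
    then show ?thesis
      by (simp add: closedin_def X_def Compl_eq_Diff_UNIV)
  qed
  then show ?thesis
    using crowded Hausdorff zero_dimensional_cell_topology
    by (intro exI[of _ X]) (auto simp: X_def submaximal_space_def)
qed

lemma submaximal_not_first_countable_open:
  assumes sub: "submaximal_space X" and Hausdorff: "Hausdorff_space X" and crowded: "crowded_space X"
    and U: "openin X U" "U \<noteq> {}"
  shows "\<not> first_countable (subtopology X U)"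
proof
  assume fc: "first_countable (subtopology X U)"
  have inf: "infinite V" if "openin X V" "V \<noteq> {}" for V
    using infinite_openin_crowded[OF crowded Hausdorff_imp_t1_space[OF Hausdorff] that] .
  have UX: "topspace (subtopology X U) = U"
    using U(1) openin_subset by fastforce
  have open_U: "openin (subtopology X U) V \<longleftrightarrow> openin X V \<and> V \<subseteq> U" for V
    using U(1) by (simp add: openin_open_subtopology)
  obtain y where y: "y \<in> U"
    using U(2) by blast
  obtain \<B> where "countable \<B>" and \<B>: "\<And>V. V \<in> \<B> \<Longrightarrow> openin X V \<and> V \<subseteq> U"
    and base: "\<And>V. \<lbrakk>openin X V; V \<subseteq> U; y \<in> V\<rbrakk> \<Longrightarrow> \<exists>W\<in>\<B>. y \<in> W \<and> W \<subseteq> V"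
    using fc y unfolding first_countable_def UX open_U by metis
  let ?\<B> = "{V \<in> \<B>. y \<in> V}"
  have "?\<B> \<noteq> {}"
    using base[OF U(1) order_refl y] by blast
  moreover have "countable ?\<B>"
    using \<open>countable \<B>\<close> by (rule countable_subset[rotated]) blast
  ultimately obtain w :: "nat \<Rightarrow> 'a set" where w: "range w = ?\<B>"
    using range_from_nat_into by metis
  \<comment> \<open>Finite intersections make the local base at \<open>y\<close> decreasing, so that
    any choice of points \<open>s n\<close> in \<open>W n\<close> converges to
    \<open>y\<close>.\<close>
  define W where "W n = (\<Inter>k\<le>n. w k)" for n
  have W: "openin X (W n)" "y \<in> W n" for n
    using w \<B> unfolding W_def by (blast intro!: openin_Inter)+
  have "\<exists>z. z \<in> W n \<and> z \<noteq> y" for n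
    using inf[OF W(1)[of n]] W(2)[of n] finite_subset[of "W n" "{y}"] by auto
  then obtain s where s: "\<And>n. s n \<in> W n" "\<And>n. s n \<noteq> y"
    by metis
  have sX: "range s \<subseteq> topspace X"
    using s(1) openin_subset[OF W(1)] by blast
  have eventually_in: "\<exists>n. \<forall>m\<ge>n. s m \<in> V" if V: "openin X V" "y \<in> V" for V
  proof -
    obtain S where "S \<in> \<B>" "y \<in> S" "S \<subseteq> V"
      using base[of "V \<inter> U"] V y U(1) by blast
    then have "S \<in> range w"
      using w by blast
    then obtain n where "w n \<subseteq> V"
      using \<open>S \<subseteq> V\<close> by blast
    then have "s m \<in> V" if "m \<ge> n" for m
      using s(1)[of m] that by (auto simp: W_def)
    then show ?thesis
      by blast
  qed
  have "X interior_of range s = {}"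
  proof (rule ccontr)
    assume "X interior_of range s \<noteq> {}"
    then obtain x where x: "x \<in> X interior_of range s"
      by blast
    then have "x \<in> range s"
      using interior_of_subset by (rule subsetD[rotated])
    then have "x \<noteq> y" "x \<in> topspace X" "y \<in> topspace X"
      using s(2) sX y openin_subset[OF U(1)] by auto
    then obtain G V where GV: "openin X G" "openin X V" "x \<in> G" "y \<in> V" "disjnt G V"
      using Hausdorff unfolding Hausdorff_space_def by metis
    obtain n where n: "\<And>m. m \<ge> n \<Longrightarrow> s m \<in> V"
      using eventually_in GV by blast
    \<comment> \<open>From index \<open>n\<close> on the sequence stays in \<open>V\<close>, which
      is disjoint from \<open>G\<close>. The open set on the left is thus finite, yet it contains
      \<open>x\<close>.\<close>
    have "G \<inter> X interior_of range s \<subseteq> s ` {..<n}"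
    proof
      fix z assume "z \<in> G \<inter> X interior_of range s"
      then obtain m where "z = s m" "s m \<in> G"
        using interior_of_subset[of X "range s"] by blast
      with n[of m] GV(5) show "z \<in> s ` {..<n}"
        by (cases "m < n") (auto simp: disjnt_iff)
    qed
    then have "finite (G \<inter> X interior_of range s)"
      using finite_subset by blast
    then show False
      using inf[of "G \<inter> X interior_of range s"] GV(1,3) x by (auto simp: openin_Int)
  qed
  then have "closedin X (range s)"
    using sub sX by (simp add: submaximal_space_def)
  then have "openin X (topspace X - range s)" "y \<in> topspace X - range s"
    using s(2) y openin_subset[OF U(1)] by auto
  then show False
    using eventually_in by blast
qed

lemma crowded_in_closure_of_complement:
  assumes "crowded_space X" "x \<in> topspace X"
  shows "x \<in> X closure_of (topspace X - {x})"
proof -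
  have "\<exists>y. y \<noteq> x \<and> y \<in> T" if "openin X T" "x \<in> T" for T
  proof (rule ccontr)
    assume "\<nexists>y. y \<noteq> x \<and> y \<in> T"
    then have "T = {x}"
      using that(2) by blast
    then show False
      using that(1) assms by (simp add: crowded_space_def)
  qed
  then show ?thesis
    using assms(2) openin_subset[of X] unfolding in_closure_of by (meson DiffI singletonD subsetD)
qed

text \<open>The set \<open>A\<close> that defeats tightness is the complement of \<open>x\<close>: a
  witness \<open>B\<close> inside it would have empty interior, hence be closed, and so could not
  have \<open>x\<close> in its closure.\<close>

lemma submaximal_not_tight:
  assumes sub: "submaximal_space X" and crowded: "crowded_space X" and x: "x \<in> topspace X"
    and P: "\<And>B. \<lbrakk>B \<subseteq> topspace X; P X B\<rbrakk> \<Longrightarrow> X interior_of B = {}"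
  shows "\<not> tight_wrt P X"
proof
  assume "tight_wrt P X"
  then obtain B where B: "B \<subseteq> topspace X - {x}" "x \<in> X closure_of B" "P X B"
    using x crowded_in_closure_of_complement[OF crowded x]
    unfolding tight_wrt_def by (metis Diff_subset)
  then have "closedin X B"
    using sub P unfolding submaximal_space_def by blast
  with B show False
    by (auto simp: closure_of_closedin)
qed

theorem mainTheorem2:
  shows "\<exists>X :: nat topology.
           crowded_space X \<and> countable (topspace X) \<and> countably_tight X \<and> Tychonoff_space X \<and>
           \<not> tight_wrt omegaN_subspace X \<and> \<not> tight_wrt C2_subspace X"
proof -
  obtain X :: "nat topology" where X: "topspace X = UNIV" "X dim_le 0" "Hausdorff_space X"
    "crowded_space X" "submaximal_space X"
    using ex_submaximal_topology by blast
  \<comment> \<open>Every subset of \<open>nat\<close> is countable, so \<open>A\<close> itself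
    serves as \<open>B\<close>.\<close>
  have "countably_tight X"
    unfolding countably_tight_def tight_wrt_def by blast
  moreover have "Tychonoff_space X"
    using X zero_dimensional_imp_completely_regular_space Hausdorff_imp_t1_space
    unfolding Tychonoff_space_def by blast
  moreover have "\<not> tight_wrt omegaN_subspace X"
  proof (rule submaximal_not_tight[OF X(5,4)])
    show "undefined \<in> topspace X"
      by (simp add: X)
    show "X interior_of B = {}" if "B \<subseteq> topspace X" "omegaN_subspace X B" for B
      using that closure_of_subset interior_of_mono
      unfolding omegaN_subspace_def nowhere_dense_in_def by (metis subset_empty)
  qed
  moreover have "\<not> tight_wrt C2_subspace X"
  proof (rule submaximal_not_tight[OF X(5,4)])
    show "undefined \<in> topspace X"
      by (simp add: X)
    show "X interior_of B = {}" if "C2_subspace X B" for B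
    proof (rule ccontr)
      assume "X interior_of B \<noteq> {}"
      \<comment> \<open>The interior of \<open>B\<close> is a nonempty open set that would inherit
        first countability from \<open>B\<close>.\<close>
      then have "\<not> first_countable (subtopology X (X interior_of B))"
        using submaximal_not_first_countable_open[OF X(5,3,4)] openin_interior_of by metis
      moreover have "subtopology X (X interior_of B) =
          subtopology (subtopology X B) (X interior_of B)"
        by (simp add: subtopology_subtopology inf_absorb2 interior_of_subset)
      ultimately show False
        using that second_countable_imp_first_countable first_countable_subtopology
        unfolding C2_subspace_def by metis
    qed
  qed
  ultimately show ?thesis
    using X by (intro exI[of _ X]) simp
qed

end
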